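(* Let $d\ge 1$ be an integer. (a) If $\sigma$ is a multicyclic sequence with $\mathrm{EBWT}(\sigma)=a_1\ldots a_r$, then $\mathrm{EBWT}(\sigma^d)=a_1^{\,d}\cdots a_r^{\,d}$. (b) If $\mathrm{EBWT}^{-1}(a_1\ldots a_r)=\sigma$, then $\mathrm{EBWT}^{-1}(a_1^{\,d}\cdots a_r^{\,d})=\sigma^d$.
   Context: $\Omega$ is a totally ordered alphabet; $a^d$ for a letter $a$ means $d$ copies of $a$; for a sequence $s$, $s^i$ is $i$ concatenated copies and $\rho(a_1\ldots a_n)=a_na_1\ldots a_{n-1}$. A sequence is primitive if nonempty and not a power $u^e$ with $e>1$. A multicyclic sequence is a finite multiset of aperiodic cycles $(s_1)\cdots(s_r)$ ($s_i$ primitive, cycles up to rotation); $\mathcal{M}_n$ is the set of those of total length $n$. For a multicyclic sequence $\sigma$, $\sigma^d$ is obtained by multiplying the multiplicity of each cycle by $d$. Extended Burrows–Wheeler Transform: for $\sigma=(s_1)\cdots(s_r)\in\mathcal{M}_n$, let $c=\mathrm{lcm}(|s_1|,\ldots,|s_r|)$; for each cycle (with multiplicity) and each $j=0,\ldots,|s_i|-1$ form the row $(\rho^j(s_i))^{c/|s_i|}$; sort the $n$ rows lexicographically; $\mathrm{EBWT}(\sigma)\in\Omega^n$ is the last column read top to bottom. It is known (Mantaci et al.) that $\mathrm{EBWT}:\mathcal{M}_n\to\Omega^n$ is a bijection; $\mathrm{EBWT}^{-1}$ denotes its inverse. *)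

theory Defs
  imports "HOL-Library.Multiset" "HOL-Library.List_Lexorder"
begin

definition word_pow :: "'a list \<Rightarrow> nat \<Rightarrow> 'a list" where
  "word_pow s i = concat (replicate i s)"

text \<open>\<open>rho (a\<^sub>1 \<dots> a\<^sub>n) = a\<^sub>n a\<^sub>1 \<dots> a\<^sub>n\<^sub>-\<^sub>1\<close>, i.e. the inverse of \<^const>\<open>rotate1\<close>.\<close>

definition rho :: "'a list \<Rightarrow> 'a list" where
  "rho s = (if s = [] then [] else last s # butlast s)"

definition primitive :: "'a list \<Rightarrow> bool" where
  "primitive s \<longleftrightarrow> s \<noteq> [] \<and> (\<nexists>u e. e > 1 \<and> s = word_pow u e)"

text \<open>A cycle \<open>(s)\<close> is the set of all rotations of \<open>s\<close>.\<close>

definition cyc :: "'a list \<Rightarrow> 'a list set" where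
  "cyc s = {(rho ^^ j) s | j. True}"

definition multicyclic :: "'a list set multiset \<Rightarrow> bool" where
  "multicyclic \<sigma> \<longleftrightarrow> (\<forall>C \<in># \<sigma>. \<exists>s. primitive s \<and> C = cyc s)"

text \<open>The definitions below do not depend on the chosen representative;
  see \<open>EBWT_cycles\<close> and \<open>total_length_cycles\<close>.\<close>

definition rep :: "'a list set \<Rightarrow> 'a list" where
  "rep C = (SOME s. s \<in> C)"

definition total_length :: "'a list set multiset \<Rightarrow> nat" where
  "total_length \<sigma> = (\<Sum>C \<in># \<sigma>. length (rep C))"

definition multicyclic_of_length :: "nat \<Rightarrow> 'a list set multiset set" where
  "multicyclic_of_length n = {\<sigma>. multicyclic \<sigma> \<and> total_length \<sigma> = n}"

definition word_rows :: "nat \<Rightarrow> 'a list \<Rightarrow> 'a list multiset" where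
  "word_rows c s = {# word_pow ((rho ^^ j) s) (c div length s). j \<in># mset_set {0..<length s} #}"

definition EBWT_rows :: "'a list set multiset \<Rightarrow> 'a list multiset" where
  "EBWT_rows \<sigma> =
     (let c = Lcm ((\<lambda>C. length (rep C)) ` set_mset \<sigma>) in \<Sum>C \<in># \<sigma>. word_rows c (rep C))"

text \<open>The order on lists is the lexicographic one of \<^theory>\<open>HOL-Library.List_Lexorder\<close>.\<close>

definition EBWT :: "'a::linorder list set multiset \<Rightarrow> 'a list" where
  "EBWT \<sigma> = map last (sorted_list_of_multiset (EBWT_rows \<sigma>))"

definition EBWT_inv :: "'a::linorder list \<Rightarrow> 'a list set multiset" where
  "EBWT_inv w = inv_into (multicyclic_of_length (length w)) EBWT w"

text \<open>\<open>a\<^sub>1 \<dots> a\<^sub>r \<mapsto> a\<^sub>1\<^sup>d \<dots> a\<^sub>r\<^sup>d\<close>\<close>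

definition letter_pow :: "'a list \<Rightarrow> nat \<Rightarrow> 'a list" where
  "letter_pow w d = concat (map (\<lambda>a. word_pow [a] d) w)"

lemma length_rho [simp]: "length (rho s) = length s"
  by (simp add: rho_def)

lemma length_rho_funpow [simp]: "length ((rho ^^ j) s) = length s"
  by (induction j) simp_all

lemma rho_rotate1 [simp]: "rho (rotate1 s) = s"
  by (cases s) (simp_all add: rho_def)

lemma rho_rotate: "(rho ^^ j) (rotate j s) = s"
proof (induction j arbitrary: s)
  case (Suc j)
  have "(rho ^^ Suc j) (rotate (Suc j) s) = (rho ^^ j) (rho (rotate1 (rotate j s)))"
    by (simp add: funpow_swap1)
  then show ?case by (simp add: Suc del: rotate_Suc)
qed simp

lemma rho_funpow_length [simp]: "(rho ^^ length s) s = s"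
  using rho_rotate[of "length s" s] by simp

lemma word_rows_rho: "word_rows c (rho s) = word_rows c s"
proof (cases "length s")
  case 0
  then show ?thesis by (simp add: rho_def word_rows_def)
next
  case (Suc m)
  let ?f = "\<lambda>j. word_pow ((rho ^^ j) s) (c div length s)"
  have "word_rows c (rho s) = {# ?f (Suc j). j \<in># mset_set {0..<length s} #}"
    by (simp add: word_rows_def funpow_swap1)
  also have "\<dots> = {# ?f j. j \<in># mset_set (Suc ` {0..<length s}) #}"
    by (subst image_mset_mset_set [symmetric]) (simp_all add: image_mset.compositionality comp_def)
  also have "Suc ` {0..<length s} = insert (length s) {1..<length s}"
    using Suc by (auto simp: image_Suc_atLeastLessThan)
  also have "{# ?f j. j \<in># mset_set (insert (length s) {1..<length s}) #}
      = {# ?f j. j \<in># mset_set (insert 0 {1..<length s}) #}"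
    by simp
  also have "insert 0 {1..<length s} = {0..<length s}"
    using Suc by auto
  finally show ?thesis by (simp add: word_rows_def)
qed

lemma rep_cyc: obtains j where "rep (cyc s) = (rho ^^ j) s"
proof -
  have "rep (cyc s) \<in> cyc s"
    unfolding rep_def by (rule someI[of _ "(rho ^^ 0) s"]) (auto simp: cyc_def intro: exI[of _ 0])
  then show ?thesis using that by (auto simp: cyc_def)
qed

lemma length_rep_cyc [simp]: "length (rep (cyc s)) = length s"
  by (metis rep_cyc length_rho_funpow)

lemma word_rows_rep_cyc [simp]: "word_rows c (rep (cyc s)) = word_rows c s"
proof -
  have "word_rows c ((rho ^^ j) s) = word_rows c s" for j
    by (induction j) (simp_all add: word_rows_rho)
  then show ?thesis by (metis rep_cyc)
qed

lemma total_length_cycles: "total_length (mset (map cyc ss)) = sum_list (map length ss)"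
  by (induction ss) (simp_all add: total_length_def)

lemma EBWT_cycles:
  fixes ss :: "'a::linorder list list"
  defines "c \<equiv> Lcm (length ` set ss)"
  shows "EBWT (mset (map cyc ss)) =
    map last (sort (concat (map (\<lambda>s. map (\<lambda>j. word_pow ((rho ^^ j) s) (c div length s))
                                          [0..<length s]) ss)))"
proof -
  have word_rows_mset: "word_rows k s =
      mset (map (\<lambda>j. word_pow ((rho ^^ j) s) (k div length s)) [0..<length s])"
    for k and s :: "'a list" by (simp add: word_rows_def)
  have rows: "(\<Sum>C \<in># mset (map cyc ss). word_rows k (rep C)) =
      mset (concat (map (\<lambda>s. map (\<lambda>j. word_pow ((rho ^^ j) s) (k div length s)) [0..<length s]) ss))"
    for k
  proof (induction ss)
    case (Cons s ss)
    then show ?case by (simp add: word_rows_mset[of k s])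
  qed simp
  have "(\<lambda>C. length (rep C)) ` set_mset (mset (map cyc ss)) = length ` set ss"
    by (auto simp: image_image)
  then show ?thesis
    unfolding EBWT_def EBWT_rows_def Let_def rows c_def by simp
qed

end

theory Submission
  imports Defs "HOL-Library.Product_Lexorder" "HOL-Combinatorics.Permutations"
begin

text \<open>Repeating every cycle \<open>d\<close> times repeats every row \<open>d\<close> times and leaves the common row length
  unchanged, which gives (a). Part (b) then amounts to the bijectivity of the transform. Injectivity:
  the row multiset is invariant under rotation, so the sorted rows can be rebuilt column by column
  from the last column, and uniqueness of primitive roots recovers the cycles from the rows.
  Surjectivity: the permutation that stably sorts \<open>w\<close> has finite order \<open>c\<close>; reading \<open>w\<close> along its
  orbits yields \<open>n\<close> sorted rows of length \<open>c\<close> with last column \<open>w\<close>, invariant under rotation, and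
  any rotation-invariant multiset of words of length \<open>c\<close> splits into the row sets of primitive
  cycles.\<close>

section \<open>Powers and rotations of words\<close>

lemma word_pow_0 [simp]: "word_pow s 0 = []"
  by (simp add: word_pow_def)

lemma word_pow_Suc [simp]: "word_pow s (Suc k) = s @ word_pow s k"
  by (simp add: word_pow_def)

lemma word_pow_add: "word_pow s (j + k) = word_pow s j @ word_pow s k"
  by (induction j) simp_all

lemma word_pow_mult: "word_pow s (j * k) = word_pow (word_pow s j) k"
  by (induction k) (simp_all add: word_pow_add)

lemma word_pow_one [simp]: "word_pow s (Suc 0) = s"
  by simp

lemma word_pow_commute: "word_pow s k @ s = s @ word_pow s k"
  by (induction k) simp_all

lemma length_word_pow [simp]: "length (word_pow s k) = k * length s"
  by (induction k) simp_all

lemma last_word_pow: "k > 0 \<Longrightarrow> last (word_pow s k) = last s"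
proof (induction k)
  case (Suc k)
  then show ?case by (cases "k = 0") (auto simp: last_append)
qed simp

lemma word_pow_singleton: "word_pow [a] d = replicate d a"
  by (induction d) simp_all

lemma rho_snoc [simp]: "rho (s @ [x]) = x # s"
  by (simp add: rho_def)

text \<open>Write \<open>s\<close> as \<open>t\<close> followed by a letter \<open>x\<close>. Once
  the final \<open>x\<close> has moved to the front, what remains is a re-bracketing:
  \<open>shift\<close> turns copies of \<open>t x\<close> into copies of \<open>x t\<close>.\<close>

lemma rho_word_pow: "rho (word_pow s k) = word_pow (rho s) k"
proof (cases s rule: rev_cases)
  case Nil
  then show ?thesis by (induction k) (simp_all add: rho_def)
next
  case (snoc t x)
  have shift: "word_pow (t @ [x]) k @ t = t @ word_pow (x # t) k" for k
    by (induction k) simp_all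
  show ?thesis
  proof (cases k)
    case (Suc m)
    have "word_pow s k = (word_pow s m @ t) @ [x]"
      using Suc word_pow_commute[of s m] snoc by simp
    then have "rho (word_pow s k) = x # word_pow s m @ t"
      by (metis rho_snoc)
    then show ?thesis
      using Suc snoc shift by simp
  qed (simp add: rho_def)
qed

lemma rotate1_rho [simp]: "rotate1 (rho s) = s"
  by (cases s rule: rev_cases) (simp_all add: rho_def)

lemma inj_rho: "inj rho"
  by (metis injI rotate1_rho)

lemma inj_rho_funpow: "inj (rho ^^ j)"
  by (induction j) (auto simp: inj_def dest: injD[OF inj_rho])

section \<open>Primitive words\<close>

text \<open>Commuting words are powers of one word \<open>z\<close>; primitivity rules out every
  exponent other than 1.\<close>

lemma primitive_commute_eq:
  assumes "primitive s" "primitive t" "s @ t = t @ s"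
  shows "s = t"
proof -
  obtain m n z where z: "word_pow z m = s" "word_pow z n = t"
    using comm_append_are_replicate[OF assms(3)] unfolding word_pow_def by blast
  have "m = 1" "n = 1"
    using assms(1,2) z unfolding primitive_def
    by (metis word_pow_0 less_one linorder_neqE_nat)+
  then show ?thesis using z by simp
qed

text \<open>Let \<open>x\<close> be the common power. Both \<open>s @ t\<close> and
  \<open>t @ s\<close> are prefixes of \<open>x @ x\<close>, and they have the same length, so
  \<open>s\<close> and \<open>t\<close> commute.\<close>

lemma primitive_root_unique:
  assumes "primitive s" "primitive t" "word_pow s k = word_pow t l" "k > 0" "l > 0"
  shows "s = t"
proof -
  define x where "x = word_pow s k"
  have prefix: "\<exists>z. x @ x = a @ b @ z"
    if "x = word_pow a (Suc i)" "x = word_pow b (Suc j)" for a b i j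
  proof -
    have "x @ x = x @ a @ word_pow a i"
      using that(1) by simp
    \<comment> \<open>A power of \<open>a\<close> commutes with \<open>a\<close>; this brings an
      intact \<open>x\<close> right behind the first \<open>a\<close>, and that \<open>x\<close>
      starts with \<open>b\<close>.\<close>
    also have "\<dots> = a @ x @ word_pow a i"
      using word_pow_commute[of a "Suc i"] that(1) by (metis append_assoc)
    also have "\<dots> = a @ b @ word_pow b j @ word_pow a i"
      using that(2) by simp
    finally show ?thesis by blast
  qed
  obtain i j where ij: "k = Suc i" "l = Suc j"
    using assms(4,5) by (metis gr0_implies_Suc)
  have xs: "x = word_pow s (Suc i)" "x = word_pow t (Suc j)"
    using assms(3) ij by (simp_all add: x_def)
  obtain z z' where "x @ x = s @ t @ z" "x @ x = t @ s @ z'"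
    using prefix[OF xs] prefix[OF xs(2,1)] by blast
  then have "(s @ t) @ z = (t @ s) @ z'" by simp
  then have "s @ t = t @ s"
    by (subst (asm) append_eq_append_conv) auto
  then show ?thesis using primitive_commute_eq assms(1,2) by blast
qed

lemma primitive_root_exists:
  assumes "r \<noteq> []"
  obtains s k where "primitive s" "r = word_pow s k" "k > 0"
proof -
  have "\<exists>s k. primitive s \<and> r = word_pow s k \<and> k > 0"
    using assms
  proof (induction r rule: length_induct)
    case (1 r)
    show ?case
    proof (cases "primitive r")
      case True
      then show ?thesis by (metis word_pow_one zero_less_Suc)
    next
      case False
      then obtain u e where u: "e > 1" "r = word_pow u e"
        using 1 by (auto simp: primitive_def)
      have "u \<noteq> []" using u 1(2) by (metis length_0_conv length_word_pow mult_0_right)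
      then have "length u < length r" using u by simp
      then obtain s k where "primitive s" "u = word_pow s k" "k > 0"
        using 1(1) \<open>u \<noteq> []\<close> by blast
      then have "r = word_pow s (k * e)" "k * e > 0"
        using u by (simp_all add: word_pow_mult)
      then show ?thesis using \<open>primitive s\<close> by blast
    qed
  qed
  then show ?thesis using that by blast
qed

text \<open>Since \<open>rho\<close> is injective and commutes with powers, a proper power
  \<open>rho s = word_pow u e\<close> would make \<open>s\<close> a proper power of
  \<open>rotate1 u\<close>.\<close>

lemma primitive_rho: "primitive s \<Longrightarrow> primitive (rho s)"
proof -
  assume s: "primitive s"
  have "rho s \<noteq> []" using s by (simp add: primitive_def rho_def)
  moreover have "\<not> (e > 1 \<and> rho s = word_pow u e)" for u e
  proof
    assume "e > 1 \<and> rho s = word_pow u e"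
    then have "rho s = rho (word_pow (rotate1 u) e)" "e > 1"
      by (simp_all add: rho_word_pow)
    then show False
      using s inj_rho by (auto simp: primitive_def dest: injD)
  qed
  ultimately show ?thesis by (auto simp: primitive_def)
qed

lemma primitive_rho_funpow: "primitive s \<Longrightarrow> primitive ((rho ^^ j) s)"
  by (induction j) (simp_all add: primitive_rho)

text \<open>If a rotation fixes \<open>s\<close>, the two pieces it exchanges commute, hence are
  powers of one word \<open>z\<close>. Both are nonempty, so \<open>s\<close> is a power of
  \<open>z\<close> with exponent at least 2.\<close>

lemma primitive_rotation_neq:
  assumes "primitive s" "0 < m" "m < length s"
  shows "(rho ^^ m) s \<noteq> s"
proof
  assume "(rho ^^ m) s = s"
  then have "rotate m s = s"
    using rho_rotate[of m s] inj_rho_funpow[of m] by (metis injD)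
  then have comm: "drop m s @ take m s = take m s @ drop m s"
    using assms(3) by (simp add: rotate_drop_take)
  obtain i j z where z: "word_pow z i = drop m s" "word_pow z j = take m s"
    using comm_append_are_replicate[OF comm] unfolding word_pow_def by blast
  have "i > 0" "j > 0"
    using z assms by (auto intro!: gr0I)
  then have "j + i > 1" by simp
  moreover have "s = word_pow z (j + i)"
    by (simp add: word_pow_add z)
  ultimately show False
    using assms(1) unfolding primitive_def by blast
qed

lemma inj_on_rotations:
  assumes "primitive s"
  shows "inj_on (\<lambda>j. (rho ^^ j) s) {0..<length s}"
proof (rule linorder_inj_onI)
  fix i j assume ij: "i < j" "i \<in> {0..<length s}" "j \<in> {0..<length s}"
  have "(rho ^^ j) s = (rho ^^ i) ((rho ^^ (j - i)) s)"
    using ij(1) by (metis comp_apply funpow_add le_add_diff_inverse less_imp_le)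
  moreover have "(rho ^^ (j - i)) s \<noteq> s"
    using primitive_rotation_neq[OF assms] ij by simp
  ultimately show "(rho ^^ i) s \<noteq> (rho ^^ j) s"
    using inj_rho_funpow[of i] by (metis injD)
qed auto

lemma cyc_rho: "cyc (rho s) = cyc s"
proof -
  have "(rho ^^ j) s \<in> cyc (rho s)" for j
  proof (cases j)
    case 0
    \<comment> \<open>The remaining \<open>length s - 1\<close> rotations complete a full turn, so
      \<open>s\<close> lies in the cycle of \<open>rho s\<close>.\<close>
    have "(rho ^^ (length s - 1)) (rho s) = s"
    proof (cases "length s")
      case (Suc m)
      then show ?thesis using rho_funpow_length[of s] by (simp add: funpow_swap1)
    qed (simp add: rho_def)
    then show ?thesis using 0 by (auto simp: cyc_def) metis
  next
    case (Suc i)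
    then show ?thesis by (auto simp: cyc_def funpow_swap1)
  qed
  moreover have "(rho ^^ j) (rho s) \<in> cyc s" for j
    by (auto simp: cyc_def intro!: exI[of _ "Suc j"] simp: funpow_swap1)
  ultimately show ?thesis by (auto simp: cyc_def[of s] cyc_def[of "rho s"])
qed

lemma cyc_rho_funpow: "cyc ((rho ^^ j) s) = cyc s"
  by (induction j) (simp_all add: cyc_rho)

section \<open>Rows of a multicyclic sequence\<close>

lemma size_word_rows [simp]: "size (word_rows c s) = length s"
  by (simp add: word_rows_def)

lemma length_in_word_rows: "length s dvd c \<Longrightarrow> r \<in># word_rows c s \<Longrightarrow> length r = c"
  by (auto simp: word_rows_def)

lemma rho_word_rows: "image_mset rho (word_rows c s) = word_rows c s"
proof -
  have "image_mset rho (word_rows c s) = word_rows c (rho s)"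
    by (simp add: word_rows_def image_mset.compositionality comp_def rho_word_pow funpow_swap1)
  then show ?thesis by (simp add: word_rows_rho)
qed

lemma word_rows_scale:
  assumes "length s dvd c"
  shows "word_rows (c * k) s = image_mset (\<lambda>r. word_pow r k) (word_rows c s)"
proof -
  have "c * k div length s = c div length s * k"
    using assms by (simp add: div_mult_swap mult.commute)
  then show ?thesis
    by (simp add: word_rows_def image_mset.compositionality comp_def word_pow_mult)
qed

text \<open>The row length \<open>c\<close> is left free, so that different multicyclic sequences
  can be compared at the same row length.\<close>

definition cyclic_rows :: "nat \<Rightarrow> 'a list set multiset \<Rightarrow> 'a list multiset" where
  "cyclic_rows c \<sigma> = (\<Sum>C \<in># \<sigma>. word_rows c (rep C))"

text \<open>Positivity excludes 0, which every length divides and which would make all rows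
  empty.\<close>

definition common_multiple :: "nat \<Rightarrow> 'a list set multiset \<Rightarrow> bool" where
  "common_multiple c \<sigma> \<longleftrightarrow> c > 0 \<and> (\<forall>C \<in># \<sigma>. length (rep C) dvd c)"

lemma cyclic_rows_empty [simp]: "cyclic_rows c {#} = {#}"
  by (simp add: cyclic_rows_def)

lemma cyclic_rows_add_mset [simp]:
  "cyclic_rows c (add_mset C \<sigma>) = word_rows c (rep C) + cyclic_rows c \<sigma>"
  by (simp add: cyclic_rows_def)

lemma common_multiple_add_mset [simp]:
  "common_multiple c (add_mset C \<sigma>) \<longleftrightarrow> length (rep C) dvd c \<and> common_multiple c \<sigma>"
  by (auto simp: common_multiple_def)

lemma multicyclic_add_mset [simp]:
  "multicyclic (add_mset C \<sigma>) \<longleftrightarrow> (\<exists>s. primitive s \<and> C = cyc s) \<and> multicyclic \<sigma>"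
  by (auto simp: multicyclic_def)

lemma size_cyclic_rows: "size (cyclic_rows c \<sigma>) = total_length \<sigma>"
  by (induction \<sigma>) (simp_all add: total_length_def)

lemma length_in_cyclic_rows:
  "common_multiple c \<sigma> \<Longrightarrow> r \<in># cyclic_rows c \<sigma> \<Longrightarrow> length r = c"
  by (induction \<sigma>) (auto dest: length_in_word_rows)

lemma rho_cyclic_rows: "image_mset rho (cyclic_rows c \<sigma>) = cyclic_rows c \<sigma>"
  by (induction \<sigma>) (simp_all add: rho_word_rows)

lemma cyclic_rows_scale:
  "common_multiple c \<sigma> \<Longrightarrow>
    cyclic_rows (c * k) \<sigma> = image_mset (\<lambda>r. word_pow r k) (cyclic_rows c \<sigma>)"
  by (induction \<sigma>) (simp_all add: word_rows_scale)

lemma cyclic_rows_repeat: "cyclic_rows c (repeat_mset d \<sigma>) = repeat_mset d (cyclic_rows c \<sigma>)"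
  by (induction d) (simp_all add: cyclic_rows_def)

lemma common_multiple_Lcm:
  assumes "multicyclic \<sigma>"
  shows "common_multiple (Lcm ((\<lambda>C. length (rep C)) ` set_mset \<sigma>)) \<sigma>"
proof -
  let ?L = "(\<lambda>C. length (rep C)) ` set_mset \<sigma>"
  have "0 \<notin> ?L"
  proof
    assume "0 \<in> ?L"
    then obtain C where C: "C \<in># \<sigma>" "length (rep C) = 0" by (metis imageE)
    then obtain s where "primitive s" "C = cyc s" using assms unfolding multicyclic_def by blast
    with C(2) show False by (simp add: primitive_def)
  qed
  then have "Lcm ?L \<noteq> 0" by (simp add: Lcm_0_iff)
  moreover have "length (rep C) dvd Lcm ?L" if "C \<in># \<sigma>" for C
    using that by (intro dvd_Lcm imageI)
  ultimately show ?thesis unfolding common_multiple_def by (metis neq0_conv)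
qed

section \<open>Independence of the transform from the row length\<close>

lemma sorted_list_of_multiset_eqI:
  "mset xs = M \<Longrightarrow> sorted xs \<Longrightarrow> sorted_list_of_multiset M = xs"
  by (auto simp: sorted_sort_id)

lemma less_append_same_length:
  fixes r s :: "'a::linorder list"
  assumes "r < s" "length r = length s"
  shows "r @ u < s @ v"
  using assms lexord_sufI[of r s] by (auto simp: list_less_def)

text \<open>Because the lengths agree, a strict comparison is already decided inside the first
  copy.\<close>

lemma word_pow_mono:
  fixes r s :: "'a::linorder list"
  assumes "r \<le> s" "length r = length s"
  shows "word_pow r k \<le> word_pow s k"
proof (cases "r = s \<or> k = 0")
  case False
  then obtain m where "r < s" "k = Suc m" using assms(1) by (cases k) (auto simp: less_le)
  then show ?thesis
    using less_append_same_length[OF _ assms(2)] by (simp add: less_imp_le)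
qed auto

text \<open>Powers of words of equal length compare like the words themselves, so any common multiple
  of the cycle lengths can replace the least one.\<close>

lemma EBWT_eq:
  fixes \<sigma> :: "'a::linorder list set multiset"
  assumes "multicyclic \<sigma>" "common_multiple c \<sigma>"
  shows "EBWT \<sigma> = map last (sorted_list_of_multiset (cyclic_rows c \<sigma>))"
proof -
  define l where "l = Lcm ((\<lambda>C. length (rep C)) ` set_mset \<sigma>)"
  have l: "common_multiple l \<sigma>" using common_multiple_Lcm[OF assms(1)] by (simp add: l_def)
  have "l dvd c" using assms(2) by (auto simp: l_def common_multiple_def intro: Lcm_least)
  then obtain k where k: "c = l * k" by blast
  have "k > 0" using k assms(2) by (auto simp: common_multiple_def intro: gr0I)
  define rs where "rs = sorted_list_of_multiset (cyclic_rows l \<sigma>)"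
  have set_rs: "length r = l" if "r \<in> set rs" for r
    using that length_in_cyclic_rows[OF l] by (simp add: rs_def)
  have "sorted rs" by (simp add: rs_def)
  then have "sorted (map (\<lambda>r. word_pow r k) rs)"
    unfolding sorted_map
    by (rule sorted_wrt_mono_rel[rotated]) (simp add: word_pow_mono set_rs)
  moreover have "mset (map (\<lambda>r. word_pow r k) rs) = cyclic_rows c \<sigma>"
    unfolding k cyclic_rows_scale[OF l] by (simp add: rs_def)
  ultimately have "sorted_list_of_multiset (cyclic_rows c \<sigma>) = map (\<lambda>r. word_pow r k) rs"
    by (intro sorted_list_of_multiset_eqI)
  moreover have "EBWT \<sigma> = map last rs"
    by (simp add: EBWT_def EBWT_rows_def Let_def rs_def l_def cyclic_rows_def)
  ultimately show ?thesis
    by (simp add: last_word_pow[OF \<open>k > 0\<close>])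
qed

lemma length_EBWT: "length (EBWT \<sigma>) = total_length \<sigma>"
proof -
  have "length (sorted_list_of_multiset R) = size R" for R :: "'a list multiset"
    using size_mset[of "sorted_list_of_multiset R"] by simp
  then show ?thesis
    by (simp add: EBWT_def EBWT_rows_def Let_def size_cyclic_rows flip: cyclic_rows_def)
qed

section \<open>Repeating cycles\<close>

lemma mset_concat_replicate: "mset (concat (map (replicate d) xs)) = repeat_mset d (mset xs)"
  by (induction xs) (simp_all add: repeat_mset_distrib_add_mset)

lemma sorted_concat_replicate: "sorted xs \<Longrightarrow> sorted (concat (map (replicate d) xs))"
  by (induction xs) (auto simp: sorted_append)

lemma letter_pow_map: "letter_pow (map f xs) d = map f (concat (map (replicate d) xs))"
  by (simp add: letter_pow_def map_concat comp_def word_pow_singleton)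

lemma set_mset_repeat: "d \<ge> 1 \<Longrightarrow> set_mset (repeat_mset d M) = set_mset M"
proof (intro set_eqI)
  fix x assume "d \<ge> 1"
  then have "count (repeat_mset d M) x > 0 \<longleftrightarrow> count M x > 0" by simp
  then show "x \<in># repeat_mset d M \<longleftrightarrow> x \<in># M" by (simp only: count_greater_zero_iff)
qed

text \<open>The distinct cycles, hence the admissible row lengths, stay the same. Replicating the
  entries of a sorted list in place keeps it sorted, and reading off last letters commutes with the
  replication.\<close>

lemma EBWT_repeat:
  fixes \<sigma> :: "'a::linorder list set multiset"
  assumes "multicyclic \<sigma>" "d \<ge> 1"
  shows "EBWT (repeat_mset d \<sigma>) = letter_pow (EBWT \<sigma>) d"
proof -
  obtain c where c: "common_multiple c \<sigma>" using common_multiple_Lcm[OF assms(1)] by blast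
  have "multicyclic (repeat_mset d \<sigma>)" "common_multiple c (repeat_mset d \<sigma>)"
    using assms c by (simp_all add: multicyclic_def common_multiple_def set_mset_repeat)
  moreover have "sorted_list_of_multiset (repeat_mset d (cyclic_rows c \<sigma>)) =
      concat (map (replicate d) (sorted_list_of_multiset (cyclic_rows c \<sigma>)))"
    by (intro sorted_list_of_multiset_eqI)
      (simp_all add: mset_concat_replicate sorted_concat_replicate)
  ultimately show ?thesis
    using EBWT_eq[OF assms(1) c] EBWT_eq[of "repeat_mset d \<sigma>" c]
    by (simp add: cyclic_rows_repeat letter_pow_map)
qed

section \<open>Injectivity\<close>

text \<open>Induction on \<open>\<sigma>\<close>: a row of one of its cycles also occurs as a row of
  some cycle of \<open>\<tau>\<close>. Uniqueness of primitive roots makes the two cycles equal, and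
  their rows cancel.\<close>

lemma cyclic_rows_inject:
  assumes "multicyclic \<sigma>" "multicyclic \<tau>" "common_multiple c \<sigma>" "common_multiple c \<tau>"
    and "cyclic_rows c \<sigma> = cyclic_rows c \<tau>"
  shows "\<sigma> = \<tau>"
  using assms
proof (induction \<sigma> arbitrary: \<tau>)
  case empty
  have "\<tau> = {#}"
  proof (rule ccontr)
    assume "\<tau> \<noteq> {#}"
    then obtain C \<tau>' where \<tau>: "\<tau> = add_mset C \<tau>'" by (metis multiset_cases)
    then obtain s where "primitive s" "C = cyc s" using empty by auto
    moreover have "size (word_rows c (rep C)) = 0" using empty \<tau> by simp
    ultimately show False by (simp add: primitive_def)
  qed
  then show ?case by simp
next
  case (add C \<sigma>)
  obtain s where s: "primitive s" "C = cyc s" using add.prems by auto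
  have sc: "length s dvd c" "c > 0" using add.prems s by (auto simp: common_multiple_def)
  have "word_pow s (c div length s) \<in># word_rows c s"
    using s(1) by (auto simp: word_rows_def primitive_def intro!: image_eqI[of _ _ 0])
  then have "word_pow s (c div length s) \<in># cyclic_rows c \<tau>"
    using add.prems(5)[symmetric] s by simp
  then obtain D where D: "D \<in># \<tau>" "word_pow s (c div length s) \<in># word_rows c (rep D)"
    by (auto simp: cyclic_rows_def in_Union_mset_iff)
  obtain t where t: "primitive t" "D = cyc t" using D add.prems(2) by (auto simp: multicyclic_def)
  have tc: "length t dvd c" using add.prems(4) D t by (auto simp: common_multiple_def)
  obtain j where j: "word_pow s (c div length s) = word_pow ((rho ^^ j) t) (c div length t)"
    using D(2) unfolding t(2) word_rows_rep_cyc by (auto simp: word_rows_def)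
  have "s = (rho ^^ j) t"
    using primitive_root_unique[OF s(1) primitive_rho_funpow[OF t(1)] j] sc tc s(1) t(1)
    by (auto simp: div_greater_zero_iff dvd_imp_le primitive_def)
  then have "C = D" using s t by (simp add: cyc_rho_funpow)
  then obtain \<tau>' where \<tau>: "\<tau> = add_mset C \<tau>'" using D(1) by (metis multi_member_split)
  have "\<sigma> = \<tau>'" using add.IH[of \<tau>'] add.prems \<tau> by simp
  then show ?case using \<tau> by simp
qed

section \<open>Rebuilding the sorted rows from the last column\<close>

lemma take_mono:
  fixes r s :: "'a::linorder list"
  shows "r \<le> s \<Longrightarrow> take k r \<le> take k s"
proof (induction k arbitrary: r s)
  case (Suc k)
  then show ?case by (cases r; cases s) auto
qed simp

lemma map_mono_sort:
  assumes "mono f"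
  shows "map f (sort xs) = sort (map f xs)"
  by (rule properties_for_sort[symmetric])
    (auto simp: sorted_map intro!: sorted_wrt_mono_rel[OF _ sorted_sort] monoD[OF assms])

text \<open>Inversion of the transform: the first \<open>k\<close> columns of the sorted rows, reconstructed from the
  last column by prepending it and sorting again.\<close>

primrec leading_columns :: "'a::linorder list \<Rightarrow> nat \<Rightarrow> 'a list list" where
  "leading_columns w 0 = replicate (length w) []"
| "leading_columns w (Suc k) = sort (map2 (#) w (leading_columns w k))"

text \<open>Rotation invariance gives \<open>rs = sort (map rho rs)\<close>. The first
  \<open>k + 1\<close> letters of \<open>rho r\<close> are the last letter of \<open>r\<close> and
  the first \<open>k\<close> letters of \<open>r\<close>; truncation is monotone, so it commutes
  with sorting.\<close>

lemma leading_columns_sorted_rows: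
  fixes rs :: "'a::linorder list list"
  assumes "sorted rs" "mset (map rho rs) = mset rs" "\<And>r. r \<in> set rs \<Longrightarrow> length r = c" "k \<le> c"
  shows "map (take k) rs = leading_columns (map last rs) k"
  using assms(4)
proof (induction k)
  case 0
  show ?case by (simp add: map_replicate_const)
next
  case (Suc k)
  have rs: "rs = sort (map rho rs)"
    using assms(1,2) by (metis properties_for_sort)
  have rho_take: "take (Suc k) (rho r) = last r # take k r" if "r \<in> set rs" for r
  proof -
    have "length r = c" using assms(3) that .
    then have "r \<noteq> []" "k \<le> length r - 1" using Suc.prems by auto
    then show ?thesis by (simp add: rho_def butlast_conv_take)
  qed
  have "map (take (Suc k)) rs = sort (map (take (Suc k)) (map rho rs))"
    by (subst rs, rule map_mono_sort) (simp add: monoI take_mono)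
  also have "map (take (Suc k)) (map rho rs) = map (\<lambda>r. last r # take k r) rs"
    using rho_take by simp
  also have "\<dots> = map2 (#) (map last rs) (map (take k) rs)"
    by (simp add: map2_map_map)
  finally show ?case using Suc by simp
qed

lemma EBWT_inject:
  fixes \<sigma> \<tau> :: "'a::linorder list set multiset"
  assumes "multicyclic \<sigma>" "multicyclic \<tau>" "EBWT \<sigma> = EBWT \<tau>"
  shows "\<sigma> = \<tau>"
proof -
  obtain a b where ab: "common_multiple a \<sigma>" "common_multiple b \<tau>"
    using assms(1,2) common_multiple_Lcm by blast
  \<comment> \<open>A row length valid for both sequences; at \<open>k = c\<close> the leading
    columns are the whole rows.\<close>
  define c where "c = a * b"
  have c: "common_multiple c \<sigma>" "common_multiple c \<tau>"
    using ab by (auto simp: common_multiple_def c_def)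
  have rows: "sorted_list_of_multiset (cyclic_rows c \<upsilon>) = leading_columns (EBWT \<upsilon>) c"
    if "multicyclic \<upsilon>" "common_multiple c \<upsilon>" for \<upsilon> :: "'a list set multiset"
  proof -
    let ?rs = "sorted_list_of_multiset (cyclic_rows c \<upsilon>)"
    have len: "length r = c" if "r \<in> set ?rs" for r
      using that length_in_cyclic_rows[OF \<open>common_multiple c \<upsilon>\<close>] by simp
    have "map (take c) ?rs = leading_columns (map last ?rs) c"
      by (rule leading_columns_sorted_rows[where c = c]) (use len in \<open>simp_all add: rho_cyclic_rows\<close>)
    moreover have "map (take c) ?rs = ?rs"
      using len by (intro map_idI) simp
    ultimately show ?thesis using EBWT_eq[OF that] by simp
  qed
  have "cyclic_rows c \<sigma> = cyclic_rows c \<tau>"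
    using rows[OF assms(1) c(1)] rows[OF assms(2) c(2)] assms(3)
    by (metis mset_sorted_list_of_multiset)
  then show ?thesis using cyclic_rows_inject assms(1,2) c by blast
qed

section \<open>Surjectivity\<close>

text \<open>Closure under \<open>rho\<close> puts every rotated row into \<open>R\<close>. By
  primitivity these rows are pairwise distinct, so each is required only once and membership
  suffices for multiset inclusion.\<close>

lemma word_rows_subset:
  assumes "primitive s" "k > 0" "word_pow s k \<in># R" "image_mset rho R = R"
  shows "word_rows (k * length s) s \<subseteq># R"
proof -
  let ?f = "\<lambda>j. word_pow ((rho ^^ j) s) k"
  have s: "s \<noteq> []" using assms(1) by (simp add: primitive_def)
  have in_R: "?f j \<in># R" for j
  proof (induction j)
    case (Suc j)
    then have "rho (?f j) \<in># image_mset rho R" by simp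
    then show ?case using assms(4) by (simp add: rho_word_pow)
  qed (use assms(3) in simp)
  have "inj_on ?f {0..<length s}"
  proof (rule inj_onI)
    fix i j assume ij: "i \<in> {0..<length s}" "j \<in> {0..<length s}" "?f i = ?f j"
    have "(rho ^^ i) s = (rho ^^ j) s"
      using primitive_root_unique[OF _ _ ij(3)] assms(1,2) primitive_rho_funpow by blast
    then show "i = j" using inj_on_rotations[OF assms(1)] ij by (auto dest: inj_onD)
  qed
  then have "word_rows (k * length s) s = mset_set (?f ` {0..<length s})"
    using s by (simp add: word_rows_def image_mset_mset_set)
  also have "\<dots> \<subseteq># R"
    using in_R by (auto simp: subseteq_mset_def count_mset_set' Suc_le_eq)
  finally show ?thesis .
qed

text \<open>Strong induction on size: take the primitive root of any row and remove the rows of its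
  cycle. These are invariant under \<open>rho\<close>, hence so is the remainder.\<close>

lemma rho_closed_imp_cyclic_rows:
  assumes "image_mset rho R = R" "\<And>r. r \<in># R \<Longrightarrow> length r = c" "c > 0"
  shows "\<exists>\<sigma>. multicyclic \<sigma> \<and> common_multiple c \<sigma> \<and> cyclic_rows c \<sigma> = R"
  using assms(1,2)
proof (induction "size R" arbitrary: R rule: less_induct)
  case less
  show ?case
  proof (cases "R = {#}")
    case True
    then show ?thesis
      using assms(3) by (intro exI[of _ "{#}"]) (simp add: multicyclic_def common_multiple_def)
  next
    case False
    then obtain r where r: "r \<in># R" by blast
    then have "r \<noteq> []" using less.prems(2) assms(3) by auto
    then obtain s k where s: "primitive s" "r = word_pow s k" "k > 0"
      by (rule primitive_root_exists)
    have c: "c = k * length s" using less.prems(2)[OF r] s by simp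
    have sub: "word_rows c s \<subseteq># R"
      using word_rows_subset[of s k R] s r less.prems(1) c by simp
    define R' where "R' = R - word_rows c s"
    have R: "R = word_rows c s + R'" using sub by (simp add: R'_def)
    have "s \<noteq> []" using s by (simp add: primitive_def)
    then have "size R' < size R" by (simp add: R)
    moreover have "image_mset rho R' = R'"
      using less.prems(1) by (simp add: R rho_word_rows)
    moreover have "length q = c" if "q \<in># R'" for q
      using less.prems(2) that R by simp
    ultimately obtain \<sigma> where "multicyclic \<sigma>" "common_multiple c \<sigma>" "cyclic_rows c \<sigma> = R'"
      using less.hyps by blast
    then show ?thesis
      using s c R by (intro exI[of _ "add_mset (cyc s) \<sigma>"]) auto
  qed
qed

section \<open>The stable sorting permutation and its orbits\<close>

text \<open>Sorting the pairs of letter and position makes all entries distinct and breaks ties by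
  position; \<open>p i\<close> is the position in \<open>w\<close> of the \<open>i\<close>-th letter
  in sorted order.\<close>

lemma stable_sorting_permutation:
  fixes w :: "'a::linorder list"
  obtains p where "p permutes {..<length w}"
    "\<And>i j. i \<le> j \<Longrightarrow> j < length w \<Longrightarrow> (w ! p i, p i) \<le> (w ! p j, p j)"
proof -
  let ?n = "length w"
  define ps where "ps = sorted_list_of_set ((\<lambda>i. (w ! i, i)) ` {..<?n})"
  have inj: "inj_on (\<lambda>i. (w ! i, i)) {..<?n}" by (simp add: inj_on_def)
  have set_ps: "set ps = (\<lambda>i. (w ! i, i)) ` {..<?n}" and "sorted ps" and "distinct ps"
    by (simp_all add: ps_def)
  have len: "length ps = ?n"
    using card_image[OF inj] by (simp add: ps_def)
  define p where "p i = (if i < ?n then snd (ps ! i) else i)" for i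
  have ps_nth: "ps ! i = (w ! p i, p i)" "p i < ?n" if "i < ?n" for i
  proof -
    have "ps ! i \<in> set ps" using that len by simp
    then show "ps ! i = (w ! p i, p i)" "p i < ?n"
      using that unfolding set_ps by (auto simp: p_def)
  qed
  have "inj_on p {..<?n}"
  proof (rule inj_onI)
    fix i j assume "i \<in> {..<?n}" "j \<in> {..<?n}" "p i = p j"
    then have "ps ! i = ps ! j" using ps_nth(1) by simp
    then show "i = j"
      using \<open>distinct ps\<close> len \<open>i \<in> _\<close> \<open>j \<in> _\<close> by (simp add: nth_eq_iff_index_eq)
  qed
  moreover have "p ` {..<?n} \<subseteq> {..<?n}" using ps_nth(2) by auto
  ultimately have "bij_betw p {..<?n} {..<?n}"
    by (simp add: bij_betw_def endo_inj_surj)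
  then have "p permutes {..<?n}"
    by (rule bij_imp_permutes) (simp add: p_def)
  moreover have "(w ! p i, p i) \<le> (w ! p j, p j)" if "i \<le> j" "j < ?n" for i j
    using sorted_nth_mono[OF \<open>sorted ps\<close>, of i j] ps_nth(1) that len by simp
  ultimately show ?thesis using that by blast
qed

text \<open>Two powers of \<open>p\<close> coincide by the pigeonhole principle, and injectivity
  cancels the smaller one. The order found serves as row length.\<close>

lemma permutes_finite_order:
  assumes "p permutes S" "finite S"
  obtains c where "c > 0" "p ^^ c = id"
proof -
  have p_pow: "(p ^^ i) permutes S" for i
  proof (induction i)
    case (Suc i)
    then show ?case using permutes_compose[OF Suc assms(1)] by (metis funpow.simps(2))
  qed (simp only: funpow.simps(1) permutes_id)
  have "range (\<lambda>i::nat. p ^^ i) \<subseteq> {q. q permutes S}"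
    using p_pow by blast
  then have "finite (range (\<lambda>i::nat. p ^^ i))"
    using finite_permutations[OF assms(2)] by (rule finite_subset)
  then have "\<not> inj (\<lambda>i::nat. p ^^ i)"
    using finite_imageD infinite_UNIV_nat by blast
  then obtain i j :: nat where ij: "i < j" "p ^^ i = p ^^ j"
    unfolding inj_def by (metis linorder_neqE_nat)
  have "(p ^^ i) ((p ^^ (j - i)) x) = (p ^^ i) x" for x
    using ij by (metis comp_apply funpow_add le_add_diff_inverse less_imp_le)
  moreover have "inj (p ^^ i)"
    using p_pow permutes_inj by blast
  ultimately have "p ^^ (j - i) = id"
    by (metis injD eq_id_iff)
  then show ?thesis using that[of "j - i"] ij by simp
qed

text \<open>The first \<open>k\<close> letters of the \<open>i\<close>-th row: \<open>w \<circ> p\<close> is the sorted first column, and following \<open>p\<close>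
  amounts to deleting the first letter.\<close>

primrec orbit_word :: "'a list \<Rightarrow> (nat \<Rightarrow> nat) \<Rightarrow> nat \<Rightarrow> nat \<Rightarrow> 'a list" where
  "orbit_word w p 0 i = []"
| "orbit_word w p (Suc k) i = w ! p i # orbit_word w p k (p i)"

lemma length_orbit_word [simp]: "length (orbit_word w p k i) = k"
  by (induction k arbitrary: i) simp_all

text \<open>The recursion exposes the first letter; this exposes the last one, which the transform
  reads.\<close>

lemma orbit_word_snoc:
  "orbit_word w p (Suc k) i = orbit_word w p k i @ [w ! (p ^^ Suc k) i]"
proof (induction k arbitrary: i)
  case (Suc k)
  have "orbit_word w p (Suc (Suc k)) i = w ! p i # orbit_word w p (Suc k) (p i)"
    by simp
  also have "\<dots> = w ! p i # orbit_word w p k (p i) @ [w ! (p ^^ Suc k) (p i)]"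
    by (simp only: Suc)
  also have "\<dots> = orbit_word w p (Suc k) i @ [w ! (p ^^ Suc (Suc k)) i]"
    by (simp add: funpow_swap1)
  finally show ?case .
qed simp

lemma EBWT_surj:
  fixes w :: "'a::linorder list"
  obtains \<sigma> where "multicyclic \<sigma>" "EBWT \<sigma> = w"
proof -
  let ?n = "length w"
  obtain p where p: "p permutes {..<?n}"
    and stable: "\<And>i j. i \<le> j \<Longrightarrow> j < ?n \<Longrightarrow> (w ! p i, p i) \<le> (w ! p j, p j)"
    using stable_sorting_permutation by blast
  obtain c where c: "c > 0" "p ^^ c = id" using permutes_finite_order[OF p] by blast
  then obtain k where k: "c = Suc k" by (metis gr0_implies_Suc)
  let ?r = "orbit_word w p c"
  \<comment> \<open>If the first letters tie, stability gives \<open>p i \<le> p j\<close>, so the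
    induction hypothesis compares the tails.\<close>
  have mono: "orbit_word w p m i \<le> orbit_word w p m j" if "i \<le> j" "j < ?n" for m i j
    using that
  proof (induction m arbitrary: i j)
    case (Suc m)
    have "p j < ?n" using p Suc.prems(2) permutes_in_image[OF p, of j] by simp
    then show ?case using stable[OF Suc.prems] Suc.IH[of "p i" "p j"] by auto
  qed simp
  define rs where "rs = map ?r [0..<?n]"
  have "sorted rs"
    unfolding rs_def by (auto simp: sorted_iff_nth_mono intro: mono)
  \<comment> \<open>The orbit closes up after \<open>c\<close> steps, so row \<open>i\<close> ends
    in \<open>w ! i\<close>.\<close>
  have snoc: "?r i = orbit_word w p k i @ [w ! i]" for i
    using orbit_word_snoc[of w p k i] c(2) k by (metis id_apply)
  then have last_rs: "map last rs = w"
    by (auto simp: rs_def intro: nth_equalityI)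
  \<comment> \<open>Row \<open>p i\<close> ends in \<open>w ! p i\<close>, the first letter of row
    \<open>i\<close>. Thus \<open>rho\<close> permutes the rows along the inverse of
    \<open>p\<close>.\<close>
  have rho_r: "rho (?r (p i)) = ?r i" for i
    by (subst snoc) (simp add: k)
  have mset_rs: "mset rs = image_mset ?r (mset_set {..<?n})"
    by (simp add: rs_def lessThan_atLeast0)
  have "mset_set {..<?n} = image_mset p (mset_set {..<?n})"
    using p by (simp add: image_mset_mset_set permutes_inj_on permutes_image)
  then have "image_mset rho (mset rs) = image_mset rho (image_mset ?r (image_mset p (mset_set {..<?n})))"
    using mset_rs by simp
  also have "\<dots> = mset rs"
    by (simp add: mset_rs image_mset.compositionality comp_def rho_r)
  finally have "image_mset rho (mset rs) = mset rs" .
  moreover have "length r = c" if "r \<in># mset rs" for r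
    using that by (auto simp: rs_def)
  ultimately obtain \<sigma> where
    \<sigma>: "multicyclic \<sigma>" "common_multiple c \<sigma>" "cyclic_rows c \<sigma> = mset rs"
    using rho_closed_imp_cyclic_rows[of "mset rs" c] c(1) by blast
  have "EBWT \<sigma> = w"
    using EBWT_eq[OF \<sigma>(1,2)] \<sigma>(3) \<open>sorted rs\<close> last_rs by (simp add: sorted_sort_id)
  then show ?thesis using \<sigma>(1) that by blast
qed

text \<open>The transform preserves total length, so \<open>\<sigma>\<close> lies in the domain over
  which \<open>inv_into\<close> chooses; injectivity there leaves no other choice.\<close>

lemma EBWT_inv_eq:
  assumes "multicyclic \<sigma>" "EBWT \<sigma> = w"
  shows "EBWT_inv w = \<sigma>"
proof -
  have "inj_on EBWT (multicyclic_of_length (length w))"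
    by (rule inj_onI) (auto simp: multicyclic_of_length_def intro: EBWT_inject)
  moreover have "\<sigma> \<in> multicyclic_of_length (length w)"
    using assms length_EBWT[of \<sigma>] by (simp add: multicyclic_of_length_def)
  ultimately show ?thesis
    using inv_into_f_f[of EBWT "multicyclic_of_length (length w)" \<sigma>] assms(2)
    by (simp add: EBWT_inv_def)
qed

theorem theorem7:
  fixes d :: nat
  assumes "d \<ge> 1"
  shows "(\<forall>(\<sigma> :: 'a::linorder list set multiset) w.
            multicyclic \<sigma> \<longrightarrow> EBWT \<sigma> = w \<longrightarrow> EBWT (repeat_mset d \<sigma>) = letter_pow w d) \<and>
         (\<forall>(w :: 'a list) \<sigma>.
            EBWT_inv w = \<sigma> \<longrightarrow> EBWT_inv (letter_pow w d) = repeat_mset d \<sigma>)"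
proof (intro conjI allI impI)
  fix \<sigma> :: "'a list set multiset" and w
  assume "multicyclic \<sigma>" "EBWT \<sigma> = w"
  then show "EBWT (repeat_mset d \<sigma>) = letter_pow w d"
    using EBWT_repeat[of \<sigma> d] assms by simp
next
  fix w :: "'a list" and \<sigma>
  assume inv: "EBWT_inv w = \<sigma>"
  \<comment> \<open>Surjectivity ensures that \<open>EBWT_inv w\<close> is a genuine preimage and
    not an arbitrary value of \<open>inv_into\<close>.\<close>
  obtain \<tau> where \<tau>: "multicyclic \<tau>" "EBWT \<tau> = w" by (rule EBWT_surj)
  then have "\<tau> = \<sigma>" using EBWT_inv_eq[OF \<tau>] inv by simp
  moreover have "multicyclic (repeat_mset d \<tau>)"
    using \<tau>(1) assms by (simp add: multicyclic_def set_mset_repeat)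
  ultimately show "EBWT_inv (letter_pow w d) = repeat_mset d \<sigma>"
    using EBWT_inv_eq[of "repeat_mset d \<tau>"] EBWT_repeat[OF \<tau>(1) assms] \<tau>(2) by simp
qed

end
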